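(* Let $X$ be a compact topological space and $f:X\to X$ a continuous function. Assume that every nonempty closed, $f$-closed subset of $X$ contains a fixed point of $f$ or a smaller (i.e. properly contained) nonempty closed, $f$-closed set. Then the induced (subspace) topology on the set $\mathrm{Fix}(f)$ of fixed points of $f$ is itself compact.
   Context: "Compact" means that every open cover has a finite subcover; the Hausdorff property is not assumed. A subset $S\subseteq X$ is $f$-closed if $f(S)\subseteq S$. "Closed" refers to the topology of $X$. *)

theory Defs
  imports "HOL-Analysis.Analysis"
begin

definition f_closed :: "('a \<Rightarrow> 'a) \<Rightarrow> 'a set \<Rightarrow> bool" where
  "f_closed f S \<longleftrightarrow> f ` S \<subseteq> S"

text \<open>The function \<open>f\<close> is total on the type \<open>'a\<close>; only its fixed points in the
  underlying set of the space \<open>X\<close> are relevant.\<close>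

definition Fix :: "'a topology \<Rightarrow> ('a \<Rightarrow> 'a) \<Rightarrow> 'a set" where
  "Fix X f = {x \<in> topspace X. f x = x}"

end

theory Submission
  imports Defs
begin

text \<open>Call a set invariant if it is nonempty, closed and mapped into itself by \<open>f\<close>. Compactness
  and Zorn's lemma give a minimal invariant set inside any invariant set; since the
  hypothesis rules out a minimal one without fixed points, every invariant set contains a fixed
  point.

  Compactness of the fixed point set then follows from the finite intersection property. Let
  \<open>\<C>\<close> be a family of relatively closed subsets of the fixed point set with that property. The
  closures in \<open>X\<close> of its members meet in an invariant set \<open>K\<close>: it is nonempty because \<open>X\<close> is
  compact, and \<open>f\<close> preserves it because continuity gives \<open>f(cl A) \<subseteq> cl(f(A)) = cl A\<close> for a set \<open>A\<close>
  of fixed points. A fixed point in \<open>K\<close> lies in every member of \<open>\<C>\<close>, because relatively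
  closed sets recover from their closure no new fixed points. Compactness cannot simply be inherited from \<open>X\<close>, because in a
  space that is not Hausdorff the fixed point set may fail to be closed.\<close>

text \<open>Along a chain of nonempty closed sets the intersection stays nonempty by compactness, so
  Zorn's lemma applies. It is applied to complements, which turns minimality into maximality
  and intersections into unions.\<close>

lemma minimal_closed_f_closed_subset:
  assumes "compact_space X" and "S \<noteq> {}" "closedin X S" "f_closed f S"
  obtains M where "M \<subseteq> S" "M \<noteq> {}" "closedin X M" "f_closed f M"
    "\<And>T. \<lbrakk>T \<subseteq> M; T \<noteq> {}; closedin X T; f_closed f T\<rbrakk> \<Longrightarrow> T = M"
proof -
  define \<A> where "\<A> = {W. - W \<subseteq> S \<and> - W \<noteq> {} \<and> closedin X (- W) \<and> f_closed f (- W)}"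
  have mem: "- T \<in> \<A> \<longleftrightarrow> T \<subseteq> S \<and> T \<noteq> {} \<and> closedin X T \<and> f_closed f T" for T
    by (simp add: \<A>_def)
  have "- S \<in> \<A>"
    using assms(2-4) mem by blast
  then have "\<A> \<noteq> {}"
    by blast
  moreover have "\<Union>\<C> \<in> \<A>" if "\<C> \<noteq> {}" and chain: "subset.chain \<A> \<C>" for \<C>
  proof -
    have sub: "\<C> \<subseteq> \<A>"
      using chain by (simp add: subset.chain_def)
    have closed: "closedin X C" if "C \<in> uminus ` \<C>" for C
      using sub that by (auto simp: \<A>_def)
    have "\<Inter>(uminus ` \<C>) \<noteq> {}"
    proof -
      have "\<Inter>\<F> \<noteq> {}" if \<F>: "finite \<F>" "\<F> \<subseteq> uminus ` \<C>" for \<F>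
      proof (cases "\<F> = {}")
        case False
        obtain \<D> where \<D>: "finite \<D>" "\<D> \<subseteq> \<C>" "\<F> = uminus ` \<D>"
          using finite_subset_image[OF \<F>] by auto
        have "subset.chain \<A> \<D>"
          using chain \<D>(2) unfolding subset_chain_def by (meson subset_iff)
        then have "\<Union>\<D> \<in> \<D>"
          using \<D>(1,3) False by (intro Union_in_chain) auto
        then have "- \<Union>\<D> \<noteq> {}"
          using \<D>(2) sub by (auto simp: \<A>_def)
        then show ?thesis
          by (auto simp: \<D>(3))
      qed simp
      then show ?thesis
        using closed
        by (intro compact_space_fip[THEN iffD1, OF assms(1), rule_format]) auto
    qed
    moreover have "closedin X (\<Inter>(uminus ` \<C>))"
      using \<open>\<C> \<noteq> {}\<close> closed by (intro closedin_Inter) auto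
    moreover have "f_closed f (\<Inter>(uminus ` \<C>))"
      using sub unfolding \<A>_def f_closed_def by blast
    moreover have "\<Inter>(uminus ` \<C>) \<subseteq> S"
      using \<open>\<C> \<noteq> {}\<close> sub unfolding \<A>_def by blast
    moreover have "\<Inter>(uminus ` \<C>) = - \<Union>\<C>"
      by auto
    ultimately show ?thesis
      by (simp add: \<A>_def)
  qed
  ultimately obtain W where W: "W \<in> \<A>" and maximal: "\<And>V. \<lbrakk>V \<in> \<A>; W \<subseteq> V\<rbrakk> \<Longrightarrow> V = W"
    using subset_Zorn_nonempty[of \<A>] by blast
  show ?thesis
  proof (rule that[of "- W"])
    show "- W \<subseteq> S" "- W \<noteq> {}" "closedin X (- W)" "f_closed f (- W)"
      using W by (auto simp: \<A>_def)
    show "T = - W" if "T \<subseteq> - W" "T \<noteq> {}" "closedin X T" "f_closed f T" for T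
      using maximal[of "- T"] mem[of T] that \<open>- W \<subseteq> S\<close> by blast
  qed
qed

lemma closed_f_closed_contains_fixed_point:
  assumes "compact_space X"
    and "\<And>S. \<lbrakk>S \<noteq> {}; closedin X S; f_closed f S\<rbrakk> \<Longrightarrow>
      (\<exists>x\<in>S. x \<in> Fix X f) \<or> (\<exists>T. T \<subset> S \<and> T \<noteq> {} \<and> closedin X T \<and> f_closed f T)"
    and "S \<noteq> {}" "closedin X S" "f_closed f S"
  shows "S \<inter> Fix X f \<noteq> {}"
proof -
  obtain M where M: "M \<subseteq> S" "M \<noteq> {}" "closedin X M" "f_closed f M"
    and minimal: "\<And>T. \<lbrakk>T \<subseteq> M; T \<noteq> {}; closedin X T; f_closed f T\<rbrakk> \<Longrightarrow> T = M"
    using minimal_closed_f_closed_subset[OF assms(1,3-5)] by blast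
  have "\<nexists>T. T \<subset> M \<and> T \<noteq> {} \<and> closedin X T \<and> f_closed f T"
    using minimal by blast
  then show ?thesis
    using assms(2)[OF M(2-4)] M(1) by blast
qed

lemma f_closed_closure_of_fixed_points:
  assumes "continuous_map X X f" "A \<subseteq> Fix X f"
  shows "f_closed f (X closure_of A)"
proof -
  have "f ` A = A"
    using assms(2) by (force simp: Fix_def)
  then show ?thesis
    using continuous_map_image_closure_subset[OF assms(1), of A] by (simp add: f_closed_def)
qed

theorem theorem6p12:
  fixes X :: "'a topology" and f :: "'a \<Rightarrow> 'a"
  assumes "compact_space X"
    and "continuous_map X X f"
    and "\<And>S. \<lbrakk>S \<noteq> {}; closedin X S; f_closed f S\<rbrakk> \<Longrightarrow>
      (\<exists>x\<in>S. x \<in> Fix X f) \<or> (\<exists>T. T \<subset> S \<and> T \<noteq> {} \<and> closedin X T \<and> f_closed f T)"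
  shows "compact_space (subtopology X (Fix X f))"
  unfolding compact_space_fip
proof (intro allI impI, elim conjE)
  fix \<C>
  assume closed: "\<forall>C\<in>\<C>. closedin (subtopology X (Fix X f)) C"
    and fip: "\<forall>\<F>. finite \<F> \<and> \<F> \<subseteq> \<C> \<longrightarrow> \<Inter>\<F> \<noteq> {}"
  have sub: "C \<subseteq> Fix X f" "C \<subseteq> topspace X" if "C \<in> \<C>" for C
    using closed that closedin_subset by fastforce+
  \<comment> \<open>The intersection of the empty family is the whole type, which need not be closed in \<open>X\<close>.\<close>
  show "\<Inter>\<C> \<noteq> {}"
  proof (cases "\<C> = {}")
    case False
    define K where "K = (\<Inter>C\<in>\<C>. X closure_of C)"
    have "\<Inter>\<F> \<noteq> {}" if \<F>: "finite \<F>" "\<F> \<subseteq> (closure_of) X ` \<C>" for \<F>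
    proof -
      obtain \<D> where \<D>: "finite \<D>" "\<D> \<subseteq> \<C>" "\<F> = (closure_of) X ` \<D>"
        using finite_subset_image[OF \<F>] by blast
      have "\<Inter>\<D> \<subseteq> \<Inter>\<F>"
        unfolding \<D>(3) using \<D>(2) closure_of_subset[OF sub(2)] by blast
      moreover have "\<Inter>\<D> \<noteq> {}"
        using fip \<D>(1,2) by simp
      ultimately show ?thesis
        by auto
    qed
    then have "K \<noteq> {}"
      using compact_space_fip[THEN iffD1, OF assms(1), rule_format, of "(closure_of) X ` \<C>"]
      unfolding K_def by auto
    moreover have "closedin X K"
      using False unfolding K_def by (intro closedin_Inter) auto
    moreover have "f_closed f K"
      using f_closed_closure_of_fixed_points[OF assms(2) sub(1)]
      unfolding K_def f_closed_def by blast
    ultimately have "K \<inter> Fix X f \<noteq> {}"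
      using closed_f_closed_contains_fixed_point[OF assms(1,3)] by blast
    then obtain x where x: "x \<in> K" "x \<in> Fix X f"
      by blast
    have "x \<in> C" if "C \<in> \<C>" for C
    proof -
      have "x \<in> Fix X f \<inter> X closure_of C"
        using x that by (auto simp: K_def)
      also have "\<dots> = C"
        using closed that
        by (simp add: closedin_Int_closure_of)
      finally show ?thesis .
    qed
    then show ?thesis
      by blast
  qed simp
qed

end
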